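(* Let $w\in\mathbb{C}$ with $|w|=1$, let $\varphi(z)=wz$ for $z$ in the open unit disk $\mathbb{D}$, and let $C_\varphi$ be the composition operator $C_\varphi f=f\circ\varphi$ on the Bergman space $L^2_a$. Then the set of extended eigenvalues of $C_\varphi$ is $$\mathrm{Ext}(C_\varphi)=\{w^n : n\in\mathbb{Z}\}.$$
   Context: The Bergman space $L^2_a$ is the Hilbert space of holomorphic functions $f$ on the open unit disk $\mathbb{D}$ with $\|f\|^2=\frac{1}{\pi}\int_{\mathbb{D}}|f(z)|^2\,dA(z)<\infty$, where $dA$ is Lebesgue area measure. For a bounded linear operator $A$ on a complex Hilbert space $H$, a scalar $\lambda\in\mathbb{C}$ is an extended eigenvalue of $A$ if there is a nonzero bounded linear operator $X$ on $H$ with $AX=\lambda XA$; $\mathrm{Ext}(A)$ denotes the set of all extended eigenvalues of $A$. *)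

theory Defs
  imports "HOL-Complex_Analysis.Complex_Analysis"
begin

section \<open>Complex Hilbert spaces and extended eigenvalues\<close>

class complex_hilbert_space = banach +
  fixes scaleC :: "complex \<Rightarrow> 'a \<Rightarrow> 'a" (infixr "*\<^sub>C" 75)
    and cinner :: "'a \<Rightarrow> 'a \<Rightarrow> complex"
  assumes scaleR_scaleC: "r *\<^sub>R x = complex_of_real r *\<^sub>C x"
    and scaleC_add_right: "c *\<^sub>C (x + y) = c *\<^sub>C x + c *\<^sub>C y"
    and scaleC_add_left: "(c + d) *\<^sub>C x = c *\<^sub>C x + d *\<^sub>C x"
    and scaleC_scaleC: "c *\<^sub>C (d *\<^sub>C x) = (c * d) *\<^sub>C x"
    and cinner_commute: "cinner x y = cnj (cinner y x)"
    and cinner_add_left: "cinner (x + y) z = cinner x z + cinner y z"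
    and cinner_scaleC_left: "cinner (c *\<^sub>C x) y = c * cinner x y"
    and cinner_self: "cinner x x = complex_of_real ((norm x)\<^sup>2)"

definition bounded_clinear :: "('a::complex_hilbert_space \<Rightarrow> 'b::complex_hilbert_space) \<Rightarrow> bool"
  where "bounded_clinear X \<longleftrightarrow> bounded_linear X \<and> (\<forall>c x. X (c *\<^sub>C x) = c *\<^sub>C X x)"

definition extended_eigenvalue :: "('a::complex_hilbert_space \<Rightarrow> 'a) \<Rightarrow> complex \<Rightarrow> bool"
  where "extended_eigenvalue A l \<longleftrightarrow>
    (\<exists>X. bounded_clinear X \<and> X \<noteq> (\<lambda>x. 0) \<and> (\<forall>x. A (X x) = l *\<^sub>C X (A x)))"

definition Ext :: "('a::complex_hilbert_space \<Rightarrow> 'a) \<Rightarrow> complex set"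
  where "Ext A = {l. extended_eigenvalue A l}"


section \<open>Invariance of area under rotations\<close>

lemma Complex_measurable [measurable]:
  "(\<lambda>(x, y). Complex x y) \<in> borel_measurable (borel \<Otimes>\<^sub>M borel)"
  unfolding borel_prod split_beta Complex_eq
  by (intro borel_measurable_continuous_onI continuous_intros)

lemma lborel_complex:
  "(lborel :: complex measure) = distr (lborel \<Otimes>\<^sub>M lborel) borel (\<lambda>(x, y). Complex x y)"
proof (rule lborel_eqI)
  fix l u :: complex
  assume le: "\<And>b. b \<in> Basis \<Longrightarrow> l \<bullet> b \<le> u \<bullet> b"
  have le': "Re l \<le> Re u" "Im l \<le> Im u"
    using le[of 1] le[of \<i>] by (auto simp: Basis_complex_def inner_complex_def)
  have eq: "(\<lambda>(x, y). Complex x y) -` box l u \<inter> space (lborel \<Otimes>\<^sub>M lborel)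
     = {Re l<..<Re u} \<times> {Im l<..<Im u}"
    by (auto simp: box_def Basis_complex_def inner_complex_def space_pair_measure)
  show "emeasure (distr (lborel \<Otimes>\<^sub>M lborel) borel (\<lambda>(x, y). Complex x y)) (box l u)
      = ennreal (\<Prod>b\<in>Basis. (u - l) \<bullet> b)"
    using le'
    by (subst emeasure_distr, use eq in \<open>auto simp: lborel.emeasure_pair_measure_Times
          Basis_complex_def inner_complex_def ennreal_mult intro!: measurable_compose[OF _ Complex_measurable]\<close>)
qed auto

lemma nn_integral_complex:
  fixes f :: "complex \<Rightarrow> ennreal"
  assumes [measurable]: "f \<in> borel_measurable borel"
  shows "(\<integral>\<^sup>+z. f z \<partial>lborel) = (\<integral>\<^sup>+x. \<integral>\<^sup>+y. f (Complex x y) \<partial>lborel \<partial>lborel)"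
    and "(\<integral>\<^sup>+z. f z \<partial>lborel) = (\<integral>\<^sup>+y. \<integral>\<^sup>+x. f (Complex x y) \<partial>lborel \<partial>lborel)"
proof -
  have [measurable]: "(\<lambda>(x, y). f (Complex x y)) \<in> borel_measurable (lborel \<Otimes>\<^sub>M lborel)"
    using measurable_compose[OF Complex_measurable assms] by (simp add: split_beta)
  have *: "(\<integral>\<^sup>+z. f z \<partial>lborel) = (\<integral>\<^sup>+p. f (case p of (x, y) \<Rightarrow> Complex x y) \<partial>(lborel \<Otimes>\<^sub>M lborel))"
    by (subst lborel_complex, subst nn_integral_distr) auto
  show "(\<integral>\<^sup>+z. f z \<partial>lborel) = (\<integral>\<^sup>+x. \<integral>\<^sup>+y. f (Complex x y) \<partial>lborel \<partial>lborel)"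
    by (subst *, subst lborel.nn_integral_fst[symmetric]) (auto simp: split_beta)
  show "(\<integral>\<^sup>+z. f z \<partial>lborel) = (\<integral>\<^sup>+y. \<integral>\<^sup>+x. f (Complex x y) \<partial>lborel \<partial>lborel)"
    by (subst *, subst lborel_pair.nn_integral_snd[symmetric]) (auto simp: split_beta)
qed

lemma nn_integral_shear:
  fixes f :: "complex \<Rightarrow> ennreal" and a :: real
  assumes [measurable]: "f \<in> borel_measurable borel"
  shows "(\<integral>\<^sup>+z. f z \<partial>lborel) = (\<integral>\<^sup>+z. f (z + of_real (a * Im z)) \<partial>lborel)"
    and "(\<integral>\<^sup>+z. f z \<partial>lborel) = (\<integral>\<^sup>+z. f (z + \<i> * of_real (a * Re z)) \<partial>lborel)"
proof -
  have m1: "(\<lambda>x. f (Complex x y)) \<in> borel_measurable borel" for y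
    using measurable_compose[OF _ measurable_compose[OF Complex_measurable assms], of "\<lambda>x. (x,y)" borel]
    by simp
  have m2: "(\<lambda>y. f (Complex x y)) \<in> borel_measurable borel" for x
    using measurable_compose[OF _ measurable_compose[OF Complex_measurable assms], of "\<lambda>y. (x,y)" borel]
    by simp
  have "(\<integral>\<^sup>+z. f z \<partial>lborel) = (\<integral>\<^sup>+y. \<integral>\<^sup>+x. f (Complex (x + a * y) y) \<partial>lborel \<partial>lborel)"
    unfolding nn_integral_complex(2)[OF assms]
    proof (rule nn_integral_cong)
    fix y :: real
    show "(\<integral>\<^sup>+x. f (Complex x y) \<partial>lborel) = (\<integral>\<^sup>+x. f (Complex (x + a * y) y) \<partial>lborel)"
      by (subst nn_integral_real_affine[OF m1, where c = 1 and t = "a * y"]) (simp_all add: add.commute)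
  qed
  also have "\<dots> = (\<integral>\<^sup>+z. f (z + of_real (a * Im z)) \<partial>lborel)"
    by (subst nn_integral_complex(2)) (auto intro!: nn_integral_cong arg_cong[of _ _ f] simp: complex_eq_iff)
  finally show "(\<integral>\<^sup>+z. f z \<partial>lborel) = (\<integral>\<^sup>+z. f (z + of_real (a * Im z)) \<partial>lborel)" .
  have "(\<integral>\<^sup>+z. f z \<partial>lborel) = (\<integral>\<^sup>+x. \<integral>\<^sup>+y. f (Complex x (y + a * x)) \<partial>lborel \<partial>lborel)"
    unfolding nn_integral_complex(1)[OF assms]
    proof (rule nn_integral_cong)
    fix x :: real
    show "(\<integral>\<^sup>+y. f (Complex x y) \<partial>lborel) = (\<integral>\<^sup>+y. f (Complex x (y + a * x)) \<partial>lborel)"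
      by (subst nn_integral_real_affine[OF m2, where c = 1 and t = "a * x"]) (simp_all add: add.commute)
  qed
  also have "\<dots> = (\<integral>\<^sup>+z. f (z + \<i> * of_real (a * Re z)) \<partial>lborel)"
    by (subst nn_integral_complex(1)) (auto intro!: nn_integral_cong arg_cong[of _ _ f] simp: complex_eq_iff)
  finally show "(\<integral>\<^sup>+z. f z \<partial>lborel) = (\<integral>\<^sup>+z. f (z + \<i> * of_real (a * Re z)) \<partial>lborel)" .
qed

lemma nn_integral_rotate:
  fixes f :: "complex \<Rightarrow> ennreal"
  assumes [measurable]: "f \<in> borel_measurable borel" and w: "cmod w = 1"
  shows "(\<integral>\<^sup>+z. f (w * z) \<partial>lborel) = (\<integral>\<^sup>+z. f z \<partial>lborel)"
proof -
  have gen: "(\<integral>\<^sup>+z. g (v * z) \<partial>lborel) = (\<integral>\<^sup>+z. g z \<partial>lborel)"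
    if [measurable]: "g \<in> borel_measurable borel" and v: "cmod v = 1" and s: "Im v \<noteq> 0"
    for g :: "complex \<Rightarrow> ennreal" and v
  proof -
    define a where "a = (Re v - 1) / Im v"
    have sq: "(Re v)\<^sup>2 + (Im v)\<^sup>2 = 1"
      using v by (simp add: cmod_def)
    have as: "a * Im v = Re v - 1"
      using s by (simp add: a_def)
    have as2: "a * (Re v + 1) = - Im v"
      using s sq by (simp add: a_def divide_simps) (simp add: power2_eq_square algebra_simps)
    define S where "S = (\<lambda>z. z + of_real (a * Im z) :: complex)"
    define T where "T = (\<lambda>z. z + \<i> * of_real (Im v * Re z) :: complex)"
    have [measurable]: "S \<in> borel_measurable borel" "T \<in> borel_measurable borel"
      unfolding S_def T_def by measurable
    have "S (T (S z)) = v * z" for z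
    proof (rule complex_eqI)
      have "Re (S (T (S z))) = (1 + a * Im v) * Re z + (a * (1 + (1 + a * Im v))) * Im z"
        by (simp add: S_def T_def algebra_simps)
      also have "\<dots> = Re v * Re z + (a * (Re v + 1)) * Im z" by (simp add: as add.commute)
      finally show "Re (S (T (S z))) = Re (v * z)" by (simp add: as2)
      have "Im (S (T (S z))) = (1 + a * Im v) * Im z + Im v * Re z"
        by (simp add: S_def T_def algebra_simps)
      then show "Im (S (T (S z))) = Im (v * z)" by (simp add: as)
    qed
    then have "(\<integral>\<^sup>+z. g (v * z) \<partial>lborel) = (\<integral>\<^sup>+z. g (S (T (S z))) \<partial>lborel)"
      by simp
    also have "\<dots> = (\<integral>\<^sup>+z. g (S (T z)) \<partial>lborel)"
      by (subst nn_integral_shear(1)[of "\<lambda>z. g (S (T z))" a]) (simp_all add: S_def)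
    also have "\<dots> = (\<integral>\<^sup>+z. g (S z) \<partial>lborel)"
      by (subst nn_integral_shear(2)[of "\<lambda>z. g (S z)" "Im v"]) (simp_all add: T_def)
    also have "\<dots> = (\<integral>\<^sup>+z. g z \<partial>lborel)"
      by (subst nn_integral_shear(1)[of "\<lambda>z. g z" a]) (simp_all add: S_def)
    finally show ?thesis .
  qed
  show ?thesis
  proof (cases "Im w = 0")
    case False
    then show ?thesis using gen[of f w] w by simp
  next
    case True
    have "(\<integral>\<^sup>+z. f (w * z) \<partial>lborel) = (\<integral>\<^sup>+z. f ((- \<i> * w) * (\<i> * z)) \<partial>lborel)"
      by (simp add: algebra_simps)
    also have "\<dots> = (\<integral>\<^sup>+z. f ((- \<i> * w) * z) \<partial>lborel)"
      by (rule gen[of "\<lambda>z. f ((- \<i> * w) * z)" \<i>]) auto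
    also have "\<dots> = (\<integral>\<^sup>+z. f z \<partial>lborel)"
      by (rule gen) (use w True in \<open>auto simp: norm_mult cmod_def\<close>)
    finally show ?thesis .
  qed
qed

lemma lborel_distr_rotate:
  assumes w: "cmod w = 1"
  shows "distr lborel borel (\<lambda>z. w * z) = lborel"
proof (rule measure_eqI)
  fix A assume "A \<in> sets (distr lborel borel (\<lambda>z. w * z))"
  then have [measurable]: "A \<in> sets borel" by simp
  have "emeasure (distr lborel borel (\<lambda>z. w * z)) A = (\<integral>\<^sup>+z. indicator A (w * z) \<partial>lborel)"
    by (subst nn_integral_indicator[symmetric], simp, subst nn_integral_distr) simp_all
  also have "\<dots> = emeasure lborel A"
    by (subst nn_integral_rotate[OF _ w, of "indicator A"]) simp_all
  finally show "emeasure (distr lborel borel (\<lambda>z. w * z)) A = emeasure lborel A" .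
qed simp


section \<open>Mean value estimates on the disk\<close>

lemma ball_measurable [measurable]: "ball (c::complex) r \<in> sets borel"
  by simp

lemma set_borel_measurable_disk:
  fixes f :: "complex \<Rightarrow> complex"
  assumes "f holomorphic_on ball 0 1"
  shows "(\<lambda>z. indicator (ball 0 1) z *\<^sub>R f z) \<in> borel_measurable borel"
  using assms by (intro borel_measurable_continuous_on_indicator) 
    (auto intro: holomorphic_on_imp_continuous_on)

lemma disk_density_measurable:
  fixes f :: "complex \<Rightarrow> complex"
  assumes "f holomorphic_on ball 0 1"
  shows "(\<lambda>z. indicator (ball 0 1) z * ennreal (cmod (f z) ^ n)) \<in> borel_measurable borel"
proof -
  define F where "F z = indicat_real (ball 0 1) z *\<^sub>R f z" for z
  have [measurable]: "F \<in> borel_measurable borel"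
    using set_borel_measurable_disk[OF assms] by (simp add: F_def[abs_def])
  have "(\<lambda>z. indicator (ball 0 1) z * ennreal (cmod (f z) ^ n)) =
        (\<lambda>z. indicator (ball 0 1) z * ennreal (cmod (F z) ^ n))"
    by (auto simp: F_def indicator_def)
  also have "\<dots> \<in> borel_measurable borel" by measurable
  finally show ?thesis .
qed

lemma circle_mean_bound:
  fixes h :: "complex \<Rightarrow> complex"
  assumes h: "h holomorphic_on ball 0 1" and z: "z \<in> ball 0 1"
  shows "ennreal (2 * pi * cmod (h 0)) \<le> (\<integral>\<^sup>+t. indicator {0..2*pi} t * ennreal (cmod (h (cis t * z))) \<partial>lborel)"
proof -
  have in_disk: "u * z \<in> ball 0 1" if "u \<in> cball 0 1" for u
    using that z mult_left_le_one_le[of "cmod z" "cmod u"] by (auto simp: norm_mult intro: le_less_trans)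
  have hol: "(\<lambda>u. h (u * z)) holomorphic_on cball 0 1"
    by (rule holomorphic_on_compose_gen[of "\<lambda>u. u * z" _ h "ball 0 1", unfolded o_def, OF _ h])
      (use in_disk in \<open>auto intro!: holomorphic_intros\<close>)
  have "((\<lambda>u. h (u * z) / (u - 0)) has_contour_integral 2 * of_real pi * \<i> * h (0 * z)) (circlepath 0 1)"
    by (rule Cauchy_integral_circlepath_simple[OF hol]) simp
  then have "((\<lambda>t. h (cis t * z) / cis t * \<i> * cis t) has_integral 2 * of_real pi * \<i> * h 0) {0..2*pi}"
    unfolding circlepath_def by (subst (asm) has_contour_integral_part_circlepath_iff) auto
  then have "((\<lambda>t. - \<i> * (h (cis t * z) / cis t * \<i> * cis t)) has_integral - \<i> * (2 * of_real pi * \<i> * h 0)) {0..2*pi}"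
    by (rule has_integral_mult_right)
  then have int: "((\<lambda>t. h (cis t * z)) has_integral 2 * of_real pi * h 0) {0..2*pi}"
    by (simp add: field_simps)
  have "continuous_on {0..2*pi} (\<lambda>t. h (cis t * z))"
    by (rule continuous_on_compose2[OF holomorphic_on_imp_continuous_on[OF hol], of _ cis, simplified])
      (auto intro!: continuous_intros)
  then have si: "set_integrable lborel {0..2*pi} (\<lambda>t. h (cis t * z))"
    by (rule borel_integrable_atLeastAtMost')
  then have "(LINT t:{0..2*pi}|lborel. h (cis t * z)) = 2 * of_real pi * h 0"
    using int by (subst set_borel_integral_eq_integral) (auto simp: integral_unique)
  then have "2 * pi * cmod (h 0) = cmod (LINT t:{0..2*pi}|lborel. h (cis t * z))"
    by (simp add: norm_mult)
  also have "ennreal \<dots> \<le> (\<integral>\<^sup>+t. ennreal (cmod (indicator {0..2*pi} t *\<^sub>R h (cis t * z))) \<partial>lborel)"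
    unfolding set_lebesgue_integral_def
    by (rule integral_norm_bound_ennreal) (use si in \<open>simp add: set_integrable_def\<close>)
  also have "\<dots> = (\<integral>\<^sup>+t. indicator {0..2*pi} t * ennreal (cmod (h (cis t * z))) \<partial>lborel)"
    by (intro nn_integral_cong) (simp add: indicator_def)
  finally show ?thesis .
qed

lemma disk_mean_bound:
  fixes h :: "complex \<Rightarrow> complex"
  assumes h: "h holomorphic_on ball 0 1"
  shows "ennreal (pi * cmod (h 0)) \<le> (\<integral>\<^sup>+z. indicator (ball 0 1) z * ennreal (cmod (h z)) \<partial>lborel)"
    (is "_ \<le> ?N")
proof -
  define g where "g z = indicator (ball 0 1) z * ennreal (cmod (h z))" for z
  have g [measurable]: "g \<in> borel_measurable borel"
    using disk_density_measurable[OF h, of 1] by (simp add: g_def[abs_def])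
  have cis_mult: "(\<lambda>(t, z). cis t * z) \<in> borel_measurable (borel \<Otimes>\<^sub>M borel)"
    unfolding borel_prod split_beta by (intro borel_measurable_continuous_onI continuous_intros)
  have [measurable]: "(\<lambda>(t, z). g (cis t * z)) \<in> borel_measurable (lborel \<Otimes>\<^sub>M lborel)"
    using measurable_compose[OF cis_mult g] by (simp add: split_beta)
  have area: "emeasure lborel (ball (0::complex) 1) = ennreal pi"
    by (subst emeasure_ball) (auto simp: unit_ball_vol_2)
  have "ennreal (2 * pi) * ennreal (pi * cmod (h 0))
      = (\<integral>\<^sup>+z. indicator (ball 0 1) (z::complex) * ennreal (2 * pi * cmod (h 0)) \<partial>lborel)"
    by (subst nn_integral_multc) (auto simp: area ennreal_mult[symmetric] algebra_simps)
  also have "\<dots> \<le> (\<integral>\<^sup>+z. \<integral>\<^sup>+t. indicator {0..2*pi} t * g (cis t * z) \<partial>lborel \<partial>lborel)"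
  proof (rule nn_integral_mono)
    fix z :: complex
    show "indicator (ball 0 1) z * ennreal (2 * pi * cmod (h 0))
        \<le> (\<integral>\<^sup>+t. indicator {0..2*pi} t * g (cis t * z) \<partial>lborel)"
    proof (cases "z \<in> ball 0 1")
      case True
      then have "g (cis t * z) = ennreal (cmod (h (cis t * z)))" for t
        by (simp add: g_def norm_mult)
      with True circle_mean_bound[OF h True] show ?thesis by simp
    qed simp
  qed
  also have "\<dots> = (\<integral>\<^sup>+t. \<integral>\<^sup>+z. indicator {0..2*pi} t * g (cis t * z) \<partial>lborel \<partial>lborel)"
    by (rule lborel_pair.Fubini') (simp add: split_beta)
  also have "\<dots> = (\<integral>\<^sup>+t. indicator {0..2*pi} t * ?N \<partial>lborel)"
  proof (rule nn_integral_cong)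
    fix t :: real
    have "(\<integral>\<^sup>+z. indicator {0..2*pi} t * g (cis t * z) \<partial>lborel) = indicator {0..2*pi} t * (\<integral>\<^sup>+z. g (cis t * z) \<partial>lborel)"
      by (rule nn_integral_cmult) measurable
    also have "(\<integral>\<^sup>+z. g (cis t * z) \<partial>lborel) = ?N"
      by (subst nn_integral_rotate) (simp, simp, simp add: g_def[abs_def])
    finally show "(\<integral>\<^sup>+z. indicator {0..2*pi} t * g (cis t * z) \<partial>lborel) = indicator {0..2*pi} t * ?N" .
  qed
  also have "\<dots> = ennreal (2 * pi) * ?N"
    by (subst nn_integral_multc) auto
  finally show ?thesis
    by (subst (asm) ennreal_mult_le_mult_iff) auto
qed

lemma nn_integral_complex_affine:
  fixes f :: "complex \<Rightarrow> ennreal"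
  assumes [measurable]: "f \<in> borel_measurable borel" and r: "r > 0"
  shows "(\<integral>\<^sup>+z. f z \<partial>lborel) = ennreal (r\<^sup>2) * (\<integral>\<^sup>+z. f (a + r *\<^sub>R z) \<partial>lborel)"
  by (subst lborel_affine[of r a])
     (use r in \<open>auto simp: nn_integral_density nn_integral_distr nn_integral_cmult\<close>)

lemma disk_point_bound:
  fixes f :: "complex \<Rightarrow> complex"
  assumes f: "f holomorphic_on ball 0 1" and a: "a \<in> ball 0 1"
  shows "ennreal (pi * (1 - cmod a)\<^sup>2 * (cmod (f a))\<^sup>2)
    \<le> (\<integral>\<^sup>+z. indicator (ball 0 1) z * ennreal ((cmod (f z))\<^sup>2) \<partial>lborel)"
proof -
  define r where "r = 1 - cmod a"
  have r: "r > 0" using a by (simp add: r_def)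
  have in_disk: "a + r *\<^sub>R u \<in> ball 0 1" if "u \<in> ball 0 1" for u
  proof -
    have "cmod (a + r *\<^sub>R u) \<le> cmod a + r * cmod u"
      using norm_triangle_ineq[of a "r *\<^sub>R u"] r by simp
    also have "\<dots> < cmod a + r * 1" using that r by (intro add_strict_left_mono mult_strict_left_mono) auto
    finally show ?thesis by (simp add: r_def)
  qed
  define g where "g z = indicator (ball 0 1) z * ennreal ((cmod (f z))\<^sup>2)" for z
  have g [measurable]: "g \<in> borel_measurable borel"
    unfolding g_def by (rule disk_density_measurable[OF f])
  have "(\<lambda>u. a + r *\<^sub>R u) holomorphic_on ball 0 1"
    unfolding scaleR_conv_of_real by (intro holomorphic_intros)
  then have hol: "(\<lambda>u. (f (a + r *\<^sub>R u))\<^sup>2) holomorphic_on ball 0 1"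
    by (intro holomorphic_on_power holomorphic_on_compose_gen[of "\<lambda>u. a + r *\<^sub>R u" _ f "ball 0 1", unfolded o_def, OF _ f])
      (use in_disk in auto)
  have "ennreal (pi * (1 - cmod a)\<^sup>2 * (cmod (f a))\<^sup>2) = ennreal (r\<^sup>2) * ennreal (pi * cmod ((f (a + r *\<^sub>R 0))\<^sup>2))"
    by (simp add: r_def norm_power ennreal_mult[symmetric] algebra_simps)
  also have "\<dots> \<le> ennreal (r\<^sup>2) * (\<integral>\<^sup>+u. indicator (ball 0 1) u * ennreal (cmod ((f (a + r *\<^sub>R u))\<^sup>2)) \<partial>lborel)"
    by (intro mult_left_mono disk_mean_bound[OF hol]) auto
  also have "\<dots> \<le> ennreal (r\<^sup>2) * (\<integral>\<^sup>+u. g (a + r *\<^sub>R u) \<partial>lborel)"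
    by (intro mult_left_mono nn_integral_mono) (use in_disk in \<open>auto simp: g_def norm_power indicator_def\<close>)
  also have "\<dots> = (\<integral>\<^sup>+z. g z \<partial>lborel)"
    by (rule nn_integral_complex_affine[symmetric]) (use r in auto)
  finally show ?thesis by (simp add: g_def)
qed


section \<open>The Bergman space\<close>

text \<open>An element is represented by its extension by zero to the whole plane, so that two elements
  are equal iff they agree on the disk.\<close>

typedef bergman = "{f :: complex \<Rightarrow> complex. f holomorphic_on ball 0 1 \<and> (\<forall>z. z \<notin> ball 0 1 \<longrightarrow> f z = 0) \<and>
    set_integrable lborel (ball 0 1) (\<lambda>z. (cmod (f z))\<^sup>2)}"
  morphisms bergman_fun Abs_bergman
  by (rule exI[of _ "\<lambda>_. 0"]) (auto simp: set_integrable_def)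

text \<open>The composition operator; it is meaningful when \<open>f \<circ> \<phi>\<close> is again in the Bergman space for
  every \<open>f\<close>, see \<open>bergman_fun_composition_rotation\<close> below for the case of a rotation.\<close>

definition composition_operator :: "(complex \<Rightarrow> complex) \<Rightarrow> bergman \<Rightarrow> bergman"
  where "composition_operator \<phi> f =
    Abs_bergman (\<lambda>z. if z \<in> ball 0 1 then bergman_fun f (\<phi> z) else 0)"

lemma set_borel_measurable_continuous_disk:
  fixes g :: "complex \<Rightarrow> 'b::real_normed_vector"
  assumes "continuous_on (ball 0 1) g"
  shows "set_borel_measurable lborel (ball 0 1) g"
  unfolding set_borel_measurable_def
  using borel_measurable_continuous_on_indicator[OF _ assms] by simp

definition sq_integrable_disk :: "(complex \<Rightarrow> complex) \<Rightarrow> bool"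
  where "sq_integrable_disk f \<longleftrightarrow> f holomorphic_on ball 0 1 \<and>
    set_integrable lborel (ball 0 1) (\<lambda>z. (cmod (f z))\<^sup>2)"

lemma sq_integrable_disk_iff:
  "sq_integrable_disk f \<longleftrightarrow> f holomorphic_on ball 0 1 \<and>
    (\<integral>\<^sup>+z. indicator (ball 0 1) z * ennreal ((cmod (f z))\<^sup>2) \<partial>lborel) < \<infinity>"
proof (cases "f holomorphic_on ball 0 1")
  case True
  have "(\<lambda>z. indicat_real (ball 0 1) z *\<^sub>R (cmod (f z))\<^sup>2) \<in> borel_measurable borel"
    using True by (intro borel_measurable_continuous_on_indicator)
      (auto intro!: continuous_intros holomorphic_on_imp_continuous_on)
  moreover have "(\<integral>\<^sup>+z. indicator (ball 0 1) z * ennreal ((cmod (f z))\<^sup>2) \<partial>lborel)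
      = (\<integral>\<^sup>+z. ennreal (norm (indicat_real (ball 0 1) z *\<^sub>R (cmod (f z))\<^sup>2)) \<partial>lborel)"
    by (intro nn_integral_cong) (auto simp: indicator_def)
  ultimately show ?thesis
    unfolding sq_integrable_disk_def set_integrable_def integrable_iff_bounded using True by simp
qed (simp add: sq_integrable_disk_def)

lemma sq_integrable_disk_add:
  assumes "sq_integrable_disk f" "sq_integrable_disk g"
  shows "sq_integrable_disk (\<lambda>z. f z + g z)"
proof -
  let ?D = "ball (0::complex) 1"
  have f: "f holomorphic_on ?D" "set_integrable lborel ?D (\<lambda>z. (cmod (f z))\<^sup>2)"
    and g: "g holomorphic_on ?D" "set_integrable lborel ?D (\<lambda>z. (cmod (g z))\<^sup>2)"
    using assms by (auto simp: sq_integrable_disk_def)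
  have fg: "(\<lambda>z. f z + g z) holomorphic_on ?D" using f g by (intro holomorphic_intros)
  have "set_integrable lborel ?D (\<lambda>z. (cmod (f z + g z))\<^sup>2)"
  proof (rule set_integrable_bound[where f = "\<lambda>z. 2 * (cmod (f z))\<^sup>2 + 2 * (cmod (g z))\<^sup>2"])
    show "set_integrable lborel ?D (\<lambda>z. 2 * (cmod (f z))\<^sup>2 + 2 * (cmod (g z))\<^sup>2)"
      using f g by (intro set_integral_add set_integrable_mult_right) auto
    show "set_borel_measurable lborel ?D (\<lambda>z. (cmod (f z + g z))\<^sup>2)"
      using f(1) g(1) by (intro set_borel_measurable_continuous_disk continuous_intros holomorphic_on_imp_continuous_on)
    show "AE z in lborel. z \<in> ?D \<longrightarrow> norm ((cmod (f z + g z))\<^sup>2) \<le> norm (2 * (cmod (f z))\<^sup>2 + 2 * (cmod (g z))\<^sup>2)"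
    proof (intro AE_I2 impI)
      fix z
      have "(cmod (f z + g z))\<^sup>2 \<le> (cmod (f z) + cmod (g z))\<^sup>2"
        by (intro power_mono norm_triangle_ineq) auto
      also have "\<dots> \<le> 2 * (cmod (f z))\<^sup>2 + 2 * (cmod (g z))\<^sup>2"
        using sum_squares_bound[of "cmod (f z)" "cmod (g z)"] by (simp add: power2_sum)
      finally show "norm ((cmod (f z + g z))\<^sup>2) \<le> norm (2 * (cmod (f z))\<^sup>2 + 2 * (cmod (g z))\<^sup>2)"
        by simp
    qed
  qed
  with fg show ?thesis by (simp add: sq_integrable_disk_def)
qed

lemma sq_integrable_disk_mult:
  assumes "sq_integrable_disk f"
  shows "sq_integrable_disk (\<lambda>z. c * f z)"
  using assms
  by (auto simp: sq_integrable_disk_def norm_mult power_mult_distrib intro!: holomorphic_intros set_integrable_mult_right)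

lemma sq_integrable_disk_rotate:
  assumes f: "sq_integrable_disk f" and w: "cmod w = 1"
  shows "sq_integrable_disk (\<lambda>z. f (w * z))"
proof -
  have f': "f holomorphic_on ball 0 1" 
    "(\<integral>\<^sup>+z. indicator (ball 0 1) z * ennreal ((cmod (f z))\<^sup>2) \<partial>lborel) < \<infinity>"
    using f by (auto simp: sq_integrable_disk_iff)
  define g where "g z = indicator (ball 0 1) z * ennreal ((cmod (f z))\<^sup>2)" for z
  have [measurable]: "g \<in> borel_measurable borel"
    unfolding g_def by (rule disk_density_measurable[OF f'(1)])
  have "(\<integral>\<^sup>+z. indicator (ball 0 1) z * ennreal ((cmod (f (w * z)))\<^sup>2) \<partial>lborel) = (\<integral>\<^sup>+z. g (w * z) \<partial>lborel)"
    by (intro nn_integral_cong) (use w in \<open>auto simp: g_def indicator_def norm_mult\<close>)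
  also have "\<dots> < \<infinity>"
    using f' w by (subst nn_integral_rotate) (simp, simp, simp add: g_def[abs_def])
  finally have "(\<integral>\<^sup>+z. indicator (ball 0 1) z * ennreal ((cmod (f (w * z)))\<^sup>2) \<partial>lborel) < \<infinity>" .
  moreover have "(\<lambda>z. f (w * z)) holomorphic_on ball 0 1"
    by (rule holomorphic_on_compose_gen[of "\<lambda>z. w * z" _ f "ball 0 1", unfolded o_def])
      (use f' w in \<open>auto intro!: holomorphic_intros simp: norm_mult\<close>)
  ultimately show ?thesis by (simp add: sq_integrable_disk_iff)
qed

lemma bergman_fun_sq_integrable: "sq_integrable_disk (bergman_fun f)"
  using bergman_fun[of f] by (simp add: sq_integrable_disk_def)

lemma bergman_fun_outside [simp]: "z \<notin> ball 0 1 \<Longrightarrow> bergman_fun f z = 0"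
  using bergman_fun[of f] by blast

lemma bergman_eqI: "(\<And>z. z \<in> ball 0 1 \<Longrightarrow> bergman_fun f z = bergman_fun g z) \<Longrightarrow> f = g"
  by (metis bergman_fun_inject bergman_fun_outside ext)

lemma bergman_fun_Abs:
  assumes "sq_integrable_disk f" 
  shows "bergman_fun (Abs_bergman (\<lambda>z. if z \<in> ball 0 1 then f z else 0)) = (\<lambda>z. if z \<in> ball 0 1 then f z else 0)"
proof (rule Abs_bergman_inverse)
  let ?f = "\<lambda>z. if z \<in> ball 0 1 then f z else 0"
  have "?f holomorphic_on ball 0 1 \<longleftrightarrow> f holomorphic_on ball 0 1"
    by (rule holomorphic_cong) auto
  moreover have "set_integrable lborel (ball 0 1) (\<lambda>z. (cmod (?f z))\<^sup>2) = set_integrable lborel (ball 0 1) (\<lambda>z. (cmod (f z))\<^sup>2)"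
    by (rule set_integrable_cong) auto
  ultimately show "?f \<in> {f. f holomorphic_on ball 0 1 \<and> (\<forall>z. z \<notin> ball 0 1 \<longrightarrow> f z = 0) \<and>
    set_integrable lborel (ball 0 1) (\<lambda>z. (cmod (f z))\<^sup>2)}"
    using assms by (auto simp: sq_integrable_disk_def)
qed

lemma bergman_fun_Abs':
  assumes "sq_integrable_disk f" "\<And>z. z \<notin> ball 0 1 \<Longrightarrow> f z = 0"
  shows "bergman_fun (Abs_bergman f) = f"
proof -
  have "(\<lambda>z. if z \<in> ball 0 1 then f z else 0) = f" using assms(2) by auto
  with bergman_fun_Abs[OF assms(1)] show ?thesis by simp
qed

lemma bergman_fun_composition_rotation:
  assumes "cmod w = 1"
  shows "bergman_fun (composition_operator (\<lambda>z. w * z) f) z = bergman_fun f (w * z)"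
  unfolding composition_operator_def
  using bergman_fun_Abs[OF sq_integrable_disk_rotate[OF bergman_fun_sq_integrable assms, of f]] assms
  by (simp add: norm_mult)

lemma bergman_mult_integrable:
  "set_integrable lborel (ball 0 1) (\<lambda>z. bergman_fun f z * cnj (bergman_fun g z))"
proof (rule set_integrable_bound[where f = "\<lambda>z. (cmod (bergman_fun f z))\<^sup>2 + (cmod (bergman_fun g z))\<^sup>2"])
  let ?D = "ball (0::complex) 1"
  have f: "bergman_fun f holomorphic_on ?D" "set_integrable lborel ?D (\<lambda>z. (cmod (bergman_fun f z))\<^sup>2)"
    and g: "bergman_fun g holomorphic_on ?D" "set_integrable lborel ?D (\<lambda>z. (cmod (bergman_fun g z))\<^sup>2)"
    using bergman_fun_sq_integrable by (auto simp: sq_integrable_disk_def)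
  show "set_integrable lborel ?D (\<lambda>z. (cmod (bergman_fun f z))\<^sup>2 + (cmod (bergman_fun g z))\<^sup>2)"
    using f g by (intro set_integral_add) auto
  show "set_borel_measurable lborel ?D (\<lambda>z. bergman_fun f z * cnj (bergman_fun g z))"
    using f(1) g(1) by (intro set_borel_measurable_continuous_disk continuous_intros holomorphic_on_imp_continuous_on)
  show "AE z in lborel. z \<in> ?D \<longrightarrow> norm (bergman_fun f z * cnj (bergman_fun g z))
      \<le> norm ((cmod (bergman_fun f z))\<^sup>2 + (cmod (bergman_fun g z))\<^sup>2)"
  proof (intro AE_I2 impI)
    fix z
    have "0 \<le> cmod (bergman_fun f z) * cmod (bergman_fun g z)" by simp
    with sum_squares_bound[of "cmod (bergman_fun f z)" "cmod (bergman_fun g z)"]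
    have "cmod (bergman_fun f z) * cmod (bergman_fun g z) \<le> (cmod (bergman_fun f z))\<^sup>2 + (cmod (bergman_fun g z))\<^sup>2"
      by linarith
    then show "norm (bergman_fun f z * cnj (bergman_fun g z)) \<le> norm ((cmod (bergman_fun f z))\<^sup>2 + (cmod (bergman_fun g z))\<^sup>2)"
      by (simp add: norm_mult)
  qed
qed

definition bergman_cinner :: "bergman \<Rightarrow> bergman \<Rightarrow> complex"
  where "bergman_cinner f g = (LINT z:ball 0 1|lborel. bergman_fun f z * cnj (bergman_fun g z)) / of_real pi"

lemma bergman_cinner_self:
  "bergman_cinner f f = of_real ((LINT z:ball 0 1|lborel. (cmod (bergman_fun f z))\<^sup>2) / pi)"
  unfolding bergman_cinner_def complex_norm_square[symmetric] set_integral_complex_of_real by simp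

lemma bergman_cinner_commute: "bergman_cinner f g = cnj (bergman_cinner g f)"
proof -
  have "cnj (LINT z:ball 0 1|lborel. bergman_fun g z * cnj (bergman_fun f z))
      = (LINT z:ball 0 1|lborel. cnj (bergman_fun g z * cnj (bergman_fun f z)))"
    unfolding set_lebesgue_integral_def by (subst Bochner_Integration.integral_cnj[symmetric]) simp
  then show ?thesis
    by (simp add: bergman_cinner_def mult.commute)
qed

lemma bergman_point_bound:
  assumes z: "z \<in> ball 0 1"
  shows "cmod (bergman_fun f z)
    \<le> sqrt ((LINT z:ball 0 1|lborel. (cmod (bergman_fun f z))\<^sup>2) / pi) / (1 - cmod z)"
proof -
  let ?I = "LINT z:ball 0 1|lborel. (cmod (bergman_fun f z))\<^sup>2"
  have f: "bergman_fun f holomorphic_on ball 0 1" "set_integrable lborel (ball 0 1) (\<lambda>z. (cmod (bergman_fun f z))\<^sup>2)"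
    using bergman_fun_sq_integrable by (auto simp: sq_integrable_disk_def)
  have I: "?I \<ge> 0" unfolding set_lebesgue_integral_def by (intro integral_nonneg_AE) auto
  have "(\<integral>\<^sup>+z. indicator (ball 0 1) z * ennreal ((cmod (bergman_fun f z))\<^sup>2) \<partial>lborel)
     = (\<integral>\<^sup>+z. ennreal (indicator (ball 0 1) z *\<^sub>R (cmod (bergman_fun f z))\<^sup>2) \<partial>lborel)"
    by (intro nn_integral_cong) (simp add: indicator_def)
  also have "\<dots> = ennreal ?I"
    unfolding set_lebesgue_integral_def
    by (rule nn_integral_eq_integral) (use f in \<open>auto simp: set_integrable_def\<close>)
  finally have "pi * (1 - cmod z)\<^sup>2 * (cmod (bergman_fun f z))\<^sup>2 \<le> ?I"
    using disk_point_bound[OF f(1) z] I by (simp add: ennreal_le_iff)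
  then have "((1 - cmod z) * cmod (bergman_fun f z))\<^sup>2 \<le> ?I / pi"
    unfolding power_mult_distrib by (simp add: pos_le_divide_eq mult.commute mult.left_commute)
  then have "(1 - cmod z) * cmod (bergman_fun f z) \<le> sqrt (?I / pi)"
    by (rule real_le_rsqrt)
  then show ?thesis using z by (simp add: field_simps)
qed

instantiation bergman :: real_vector
begin

definition zero_bergman :: bergman
  where "0 = Abs_bergman (\<lambda>_. 0)"
definition plus_bergman :: "bergman \<Rightarrow> bergman \<Rightarrow> bergman"
  where "f + g = Abs_bergman (\<lambda>z. bergman_fun f z + bergman_fun g z)"
definition scaleR_bergman :: "real \<Rightarrow> bergman \<Rightarrow> bergman"
  where "r *\<^sub>R f = Abs_bergman (\<lambda>z. of_real r * bergman_fun f z)"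
definition uminus_bergman :: "bergman \<Rightarrow> bergman"
  where "- f = Abs_bergman (\<lambda>z. - bergman_fun f z)"
definition minus_bergman :: "bergman \<Rightarrow> bergman \<Rightarrow> bergman"
  where "f - g = Abs_bergman (\<lambda>z. bergman_fun f z - bergman_fun g z)"

lemma bergman_fun_zero [simp]: "bergman_fun 0 z = 0"
  unfolding zero_bergman_def by (subst bergman_fun_Abs') (auto simp: sq_integrable_disk_def set_integrable_def)

lemma bergman_fun_add [simp]: "bergman_fun (f + g) z = bergman_fun f z + bergman_fun g z"
  unfolding plus_bergman_def
  by (subst bergman_fun_Abs') (auto intro: sq_integrable_disk_add bergman_fun_sq_integrable)

lemma bergman_fun_scaleR [simp]: "bergman_fun (r *\<^sub>R f) z = of_real r * bergman_fun f z"
  unfolding scaleR_bergman_def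
  by (subst bergman_fun_Abs') (auto intro: sq_integrable_disk_mult bergman_fun_sq_integrable)

lemma bergman_fun_uminus [simp]: "bergman_fun (- f) z = - bergman_fun f z"
  unfolding uminus_bergman_def
  using sq_integrable_disk_mult[OF bergman_fun_sq_integrable, of "-1" f]
  by (subst bergman_fun_Abs') auto

lemma bergman_fun_diff [simp]: "bergman_fun (f - g) z = bergman_fun f z - bergman_fun g z"
  unfolding minus_bergman_def
  using sq_integrable_disk_add[OF bergman_fun_sq_integrable[of f] sq_integrable_disk_mult[OF bergman_fun_sq_integrable, of "-1" g]]
  by (subst bergman_fun_Abs') auto

instance
  by standard (auto intro!: bergman_eqI simp: algebra_simps)

end

instantiation bergman :: norm
begin
definition norm_bergman :: "bergman \<Rightarrow> real"
  where "norm f = sqrt ((LINT z:ball 0 1|lborel. (cmod (bergman_fun f z))\<^sup>2) / pi)"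
instance ..
end

instantiation bergman :: real_inner
begin

definition dist_bergman_def: "dist (f :: bergman) g = norm (f - g)"
definition inner_bergman :: "bergman \<Rightarrow> bergman \<Rightarrow> real"
  where "inner f g = Re (bergman_cinner f g)"
definition sgn_bergman_def: "sgn (f :: bergman) = f /\<^sub>R norm f"
definition uniformity_bergman_def:
  "(uniformity :: (bergman \<times> bergman) filter) = (INF e\<in>{0 <..}. principal {(x, y). dist x y < e})"
definition open_bergman_def:
  "open (U :: bergman set) = (\<forall>x\<in>U. \<forall>\<^sub>F (x', y) in uniformity. x' = x \<longrightarrow> y \<in> U)"

instance
proof
  fix f g h :: bergman and r :: real
  show "inner f g = inner g f"
    unfolding inner_bergman_def by (subst bergman_cinner_commute) simp
  show "inner (f + g) h = inner f h + inner g h"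
    using bergman_mult_integrable
    by (simp add: inner_bergman_def bergman_cinner_def distrib_right set_integral_add add_divide_distrib)
  show "inner (r *\<^sub>R f) g = r * inner f g"
    by (simp add: inner_bergman_def bergman_cinner_def mult.assoc flip: times_divide_eq_right)
  have I: "0 \<le> (LINT z:ball 0 1|lborel. (cmod (bergman_fun f z))\<^sup>2)"
    unfolding set_lebesgue_integral_def by (intro integral_nonneg_AE) auto
  then show "0 \<le> inner f f"
    by (simp add: inner_bergman_def bergman_cinner_self)
  show "norm f = sqrt (inner f f)"
    by (simp add: inner_bergman_def bergman_cinner_self norm_bergman_def)
  show "inner f f = 0 \<longleftrightarrow> f = 0"
  proof
    assume "inner f f = 0"
    then have "(LINT z:ball 0 1|lborel. (cmod (bergman_fun f z))\<^sup>2) = 0"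
      by (simp add: inner_bergman_def bergman_cinner_self)
    then show "f = 0"
      using bergman_point_bound[of _ f] by (intro bergman_eqI) simp
  qed (simp add: inner_bergman_def bergman_cinner_def)
qed (auto simp: dist_bergman_def sgn_bergman_def uniformity_bergman_def open_bergman_def)

end

lemma bergman_point_norm:
  "z \<in> ball 0 1 \<Longrightarrow> cmod (bergman_fun f z) \<le> norm f / (1 - cmod z)"
  using bergman_point_bound by (simp add: norm_bergman_def)

lemma bergman_nn_integral:
  "(\<integral>\<^sup>+z. indicator (ball 0 1) z * ennreal ((cmod (bergman_fun f z))\<^sup>2) \<partial>lborel) = ennreal (pi * (norm f)\<^sup>2)"
proof -
  have "(\<integral>\<^sup>+z. indicator (ball 0 1) z * ennreal ((cmod (bergman_fun f z))\<^sup>2) \<partial>lborel)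
     = (\<integral>\<^sup>+z. ennreal (indicator (ball 0 1) z *\<^sub>R (cmod (bergman_fun f z))\<^sup>2) \<partial>lborel)"
    by (intro nn_integral_cong) (simp add: indicator_def)
  also have "\<dots> = ennreal (LINT z:ball 0 1|lborel. (cmod (bergman_fun f z))\<^sup>2)"
    unfolding set_lebesgue_integral_def
    by (rule nn_integral_eq_integral)
      (use bergman_fun_sq_integrable[of f] in \<open>auto simp: set_integrable_def sq_integrable_disk_def\<close>)
  also have "(LINT z:ball 0 1|lborel. (cmod (bergman_fun f z))\<^sup>2) = pi * (norm f)\<^sup>2"
    unfolding norm_bergman_def
    by (subst real_sqrt_pow2) (auto simp: set_lebesgue_integral_def intro!: integral_nonneg_AE)
  finally show ?thesis .
qed

instance bergman :: complete_space
proof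
  fix X :: "nat \<Rightarrow> bergman"
  assume X: "Cauchy X"
  define F where "F n = bergman_fun (X n)" for n
  define f where "f z = (if z \<in> ball 0 1 then lim (\<lambda>n. F n z) else 0)" for z
  have Fhol: "F n holomorphic_on ball 0 1" for n
    using bergman_fun_sq_integrable by (simp add: F_def sq_integrable_disk_def)
  have ptw: "cmod (F m z - F n z) \<le> norm (X m - X n) / (1 - cmod z)" if "z \<in> ball 0 1" for m n z
    using bergman_point_norm[OF that, of "X m - X n"] by (simp add: F_def)
  have lims: "(\<lambda>n. F n z) \<longlonglongrightarrow> f z" if z: "z \<in> ball 0 1" for z
  proof -
    have "Cauchy (\<lambda>n. F n z)"
    proof (rule CauchyI)
      fix e :: real assume "e > 0"
      with z have "e * (1 - cmod z) > 0" by simp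
      then obtain M where M: "\<forall>m\<ge>M. \<forall>n\<ge>M. norm (X m - X n) < e * (1 - cmod z)"
        using CauchyD[OF X] by blast
      have "cmod (F m z - F n z) < e" if "m \<ge> M" "n \<ge> M" for m n
      proof -
        have "norm (X m - X n) / (1 - cmod z) < e"
          using M that z by (simp add: divide_less_eq)
        with ptw[OF z, of m n] show ?thesis by simp
      qed
      then show "\<exists>M. \<forall>m\<ge>M. \<forall>n\<ge>M. cmod (F m z - F n z) < e" by blast
    qed
    then have "convergent (\<lambda>n. F n z)" by (rule Cauchy_convergent)
    then show ?thesis using z by (simp add: f_def convergent_LIMSEQ_iff)
  qed
  have "f holomorphic_on ball 0 1"
  proof (rule holomorphic_uniform_sequence[OF _ Fhol])
    fix x :: complex assume x: "x \<in> ball 0 1"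
    define d where "d = (1 - cmod x) / 2"
    have d: "d > 0" using x by (simp add: d_def)
    have bd: "cmod z \<le> 1 - d" if "z \<in> cball x d" for z
    proof -
      have "cmod z \<le> cmod x + cmod (z - x)" by (rule norm_triangle_sub)
      with that show ?thesis by (simp add: d_def dist_norm norm_minus_commute field_simps)
    qed
    have sub: "cball x d \<subseteq> ball 0 1" using bd d by fastforce
    have "uniform_limit (cball x d) F f sequentially"
    proof (rule uniform_limitI)
      fix e :: real assume e: "e > 0"
      then have "e / 2 * d > 0" using d by simp
      then obtain M where M: "\<forall>m\<ge>M. \<forall>n\<ge>M. norm (X m - X n) < e / 2 * d"
        using CauchyD[OF X] by blast
      have "dist (F m z) (f z) < e" if m: "m \<ge> M" and z: "z \<in> cball x d" for m z
      proof -
        have zD: "z \<in> ball 0 1" using z sub by blast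
        have "cmod (F m z - F n z) \<le> e / 2" if n: "n \<ge> M" for n
        proof -
          have "cmod (F m z - F n z) \<le> norm (X m - X n) / (1 - cmod z)" by (rule ptw[OF zD])
          also have "\<dots> \<le> norm (X m - X n) / d"
            using bd[OF z] d by (intro divide_left_mono) auto
          also have "\<dots> \<le> e / 2"
            using M m n d by (simp add: divide_le_eq less_imp_le)
          finally show ?thesis .
        qed
        moreover have "(\<lambda>n. cmod (F m z - F n z)) \<longlonglongrightarrow> cmod (F m z - f z)"
          by (intro tendsto_intros lims zD)
        ultimately have "cmod (F m z - f z) \<le> e / 2"
          by (intro LIMSEQ_le_const2) auto
        with e show ?thesis by (simp add: dist_norm)
      qed
      then show "\<forall>\<^sub>F n in sequentially. \<forall>z\<in>cball x d. dist (F n z) (f z) < e"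
        unfolding eventually_sequentially by blast
    qed
    with d sub show "\<exists>d>0. cball x d \<subseteq> ball 0 1 \<and> uniform_limit (cball x d) F f sequentially"
      by blast
  qed simp
  note fhol = this
  have fatou: "(\<integral>\<^sup>+z. indicator (ball 0 1) z * ennreal ((cmod (F m z - f z))\<^sup>2) \<partial>lborel) \<le> ennreal (pi * e\<^sup>2)"
    if M: "\<And>n. n \<ge> M \<Longrightarrow> norm (X m - X n) \<le> e" and e: "e \<ge> 0" for m M e
  proof -
    have meas: "(\<lambda>z. indicator (ball 0 1) z * ennreal ((cmod (F m z - F n z))\<^sup>2)) \<in> borel_measurable lborel" for n
    proof -
      have "(\<lambda>z. F m z - F n z) holomorphic_on ball 0 1" by (intro holomorphic_intros Fhol)
      then show ?thesis by (simp add: disk_density_measurable)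
    qed
    have "(\<integral>\<^sup>+z. indicator (ball 0 1) z * ennreal ((cmod (F m z - f z))\<^sup>2) \<partial>lborel)
       = (\<integral>\<^sup>+z. liminf (\<lambda>n. indicator (ball 0 1) z * ennreal ((cmod (F m z - F n z))\<^sup>2)) \<partial>lborel)"
    proof (rule nn_integral_cong)
      fix z
      show "indicator (ball 0 1) z * ennreal ((cmod (F m z - f z))\<^sup>2)
         = liminf (\<lambda>n. indicator (ball 0 1) z * ennreal ((cmod (F m z - F n z))\<^sup>2))"
      proof (cases "z \<in> ball 0 1")
        case True
        have "(\<lambda>n. ennreal ((cmod (F m z - F n z))\<^sup>2)) \<longlonglongrightarrow> ennreal ((cmod (F m z - f z))\<^sup>2)"
          by (intro tendsto_intros tendsto_ennrealI lims True)
        from lim_imp_Liminf[OF _ this] True show ?thesis by simp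
      qed (simp add: Liminf_const)
    qed
    also have "\<dots> \<le> liminf (\<lambda>n. \<integral>\<^sup>+z. indicator (ball 0 1) z * ennreal ((cmod (F m z - F n z))\<^sup>2) \<partial>lborel)"
      by (rule nn_integral_liminf) (rule meas)
    also have "(\<lambda>n. \<integral>\<^sup>+z. indicator (ball 0 1) z * ennreal ((cmod (F m z - F n z))\<^sup>2) \<partial>lborel)
        = (\<lambda>n. ennreal (pi * (norm (X m - X n))\<^sup>2))"
      using bergman_nn_integral[of "X m - X _"] by (simp add: F_def)
    also have "liminf (\<lambda>n. ennreal (pi * (norm (X m - X n))\<^sup>2)) \<le> liminf (\<lambda>n. ennreal (pi * e\<^sup>2))"
      by (rule Liminf_mono)
        (auto simp: eventually_sequentially intro!: exI[of _ M] ennreal_leI mult_left_mono power_mono M)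
    finally show ?thesis by (simp add: Liminf_const)
  qed
  have sqd: "sq_integrable_disk (\<lambda>z. F m z - f z)"
    if M: "\<And>n. n \<ge> M \<Longrightarrow> norm (X m - X n) \<le> e" and e: "e \<ge> 0" for m M e
  proof -
    have "(\<integral>\<^sup>+z. indicator (ball 0 1) z * ennreal ((cmod (F m z - f z))\<^sup>2) \<partial>lborel) < \<infinity>"
      by (rule le_less_trans[OF fatou[of M m e]]) (use M e in auto)
    moreover have "(\<lambda>z. F m z - f z) holomorphic_on ball 0 1"
      by (intro holomorphic_intros fhol Fhol)
    ultimately show ?thesis by (simp add: sq_integrable_disk_iff)
  qed
  obtain M0 where M0: "\<forall>m\<ge>M0. \<forall>n\<ge>M0. norm (X m - X n) < 1"
    using CauchyD[OF X, of 1] by auto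
  have "sq_integrable_disk (\<lambda>z. F M0 z + (-1) * (F M0 z - f z))"
    using M0 bergman_fun_sq_integrable
    by (intro sq_integrable_disk_add sq_integrable_disk_mult sqd[of M0 _ 1]) (auto simp: F_def less_imp_le)
  then have "sq_integrable_disk f" by simp
  then have L: "bergman_fun (Abs_bergman f) = f"
    by (rule bergman_fun_Abs') (simp add: f_def)
  have "X \<longlonglongrightarrow> Abs_bergman f"
  proof (rule LIMSEQ_I)
    fix r :: real assume r: "r > 0"
    then obtain M where M: "\<forall>m\<ge>M. \<forall>n\<ge>M. norm (X m - X n) < r / 2"
      using CauchyD[OF X, of "r / 2"] by auto
    have "norm (X m - Abs_bergman f) < r" if m: "m \<ge> M" for m
    proof -
      have "ennreal (pi * (norm (X m - Abs_bergman f))\<^sup>2) \<le> ennreal (pi * (r / 2)\<^sup>2)"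
        using fatou[of M m "r / 2"] M m r bergman_nn_integral[of "X m - Abs_bergman f"]
        by (simp add: L F_def less_imp_le)
      then have "(norm (X m - Abs_bergman f))\<^sup>2 \<le> (r / 2)\<^sup>2"
        by (simp add: ennreal_le_iff)
      then have "norm (X m - Abs_bergman f) \<le> r / 2"
        by (rule power2_le_imp_le) (use r in simp)
      with r show ?thesis by simp
    qed
    then show "\<exists>no. \<forall>n\<ge>no. norm (X n - Abs_bergman f) < r" by blast
  qed
  then show "convergent X" by (rule convergentI)
qed

instantiation bergman :: complex_hilbert_space
begin

definition scaleC_bergman :: "complex \<Rightarrow> bergman \<Rightarrow> bergman"
  where "c *\<^sub>C f = Abs_bergman (\<lambda>z. c * bergman_fun f z)"
definition cinner_bergman :: "bergman \<Rightarrow> bergman \<Rightarrow> complex"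
  where "cinner f g = bergman_cinner f g"

lemma bergman_fun_scaleC [simp]: "bergman_fun (c *\<^sub>C f) z = c * bergman_fun f z"
  unfolding scaleC_bergman_def
  by (subst bergman_fun_Abs') (auto intro: sq_integrable_disk_mult bergman_fun_sq_integrable)

instance
proof
  fix f g h :: bergman and c d :: complex and r :: real
  show "r *\<^sub>R f = complex_of_real r *\<^sub>C f" "c *\<^sub>C (f + g) = c *\<^sub>C f + c *\<^sub>C g"
    "(c + d) *\<^sub>C f = c *\<^sub>C f + d *\<^sub>C f" "c *\<^sub>C (d *\<^sub>C f) = (c * d) *\<^sub>C f"
    by (auto intro!: bergman_eqI simp: algebra_simps)
  show "cinner f g = cnj (cinner g f)"
    unfolding cinner_bergman_def by (rule bergman_cinner_commute)
  show "cinner (f + g) h = cinner f h + cinner g h"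
    using bergman_mult_integrable
    by (simp add: cinner_bergman_def bergman_cinner_def distrib_right set_integral_add add_divide_distrib)
  show "cinner (c *\<^sub>C f) g = c * cinner f g"
    by (simp add: cinner_bergman_def bergman_cinner_def mult.assoc)
  show "cinner f f = complex_of_real ((norm f)\<^sup>2)"
    unfolding cinner_bergman_def bergman_cinner_self norm_bergman_def
    by (subst real_sqrt_pow2) (auto simp: set_lebesgue_integral_def intro!: integral_nonneg_AE divide_nonneg_pos)
qed

end

text \<open>Rotations induce bounded (indeed isometric) complex-linear operators.\<close>

lemma norm_composition_rotation:
  assumes w: "cmod w = 1"
  shows "norm (composition_operator (\<lambda>z. w * z) f) = norm f"
proof -
  define g where "g z = indicator (ball 0 1) z * ennreal ((cmod (bergman_fun f z))\<^sup>2)" for z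
  have "bergman_fun f holomorphic_on ball 0 1"
    using bergman_fun_sq_integrable by (simp add: sq_integrable_disk_def)
  then have [measurable]: "g \<in> borel_measurable borel"
    unfolding g_def by (rule disk_density_measurable)
  have "ennreal (pi * (norm (composition_operator (\<lambda>z. w * z) f))\<^sup>2) = (\<integral>\<^sup>+z. g (w * z) \<partial>lborel)"
    unfolding bergman_nn_integral[symmetric]
    by (intro nn_integral_cong)
       (use w in \<open>auto simp: g_def bergman_fun_composition_rotation indicator_def norm_mult\<close>)
  also have "\<dots> = ennreal (pi * (norm f)\<^sup>2)"
    using w by (subst nn_integral_rotate) (simp, simp, simp add: bergman_nn_integral[symmetric] g_def[abs_def])
  finally have "(norm (composition_operator (\<lambda>z. w * z) f))\<^sup>2 = (norm f)\<^sup>2"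
    by (subst (asm) ennreal_inj) auto
  then show ?thesis by (simp add: power2_eq_iff_nonneg)
qed

lemma bounded_clinear_composition_rotation:
  assumes w: "cmod w = 1"
  shows "bounded_clinear (composition_operator (\<lambda>z. w * z))"
  unfolding bounded_clinear_def
proof (intro conjI allI)
  show "bounded_linear (composition_operator (\<lambda>z. w * z))"
    by (rule bounded_linear_intro[where K = 1])
      (auto intro!: bergman_eqI simp: bergman_fun_composition_rotation w norm_composition_rotation)
  show "composition_operator (\<lambda>z. w * z) (c *\<^sub>C f) = c *\<^sub>C composition_operator (\<lambda>z. w * z) f" for c f
    by (auto intro!: bergman_eqI simp: bergman_fun_composition_rotation w)
qed

end

theory Submission
  imports Defs
begin

text \<open>
  Write \<open>C\<close> for the composition operator of the rotation and \<open>e\<^sub>n\<close> for the monomial \<open>z\<^sup>n\<close>.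
  The operator \<open>C\<close> is diagonal: \<open>C e\<^sub>n = w\<^sup>n e\<^sub>n\<close>, and dually the functional
  \<open>f \<mapsto> f\<^sup>(\<^sup>k\<^sup>)(0)\<close> is multiplied by \<open>w\<^sup>k\<close> when \<open>f\<close> is replaced by \<open>C f\<close>.

  Every integer power of \<open>w\<close> is an extended eigenvalue because of rank-one operators: for
  \<open>X f = f\<^sup>(\<^sup>k\<^sup>)(0) e\<^sub>j\<close> one has \<open>C X = w\<^sup>j X\<close> and \<open>X C = w\<^sup>k X\<close>, hence
  \<open>C X = (w\<^sup>j / w\<^sup>k) X C\<close> (\<open>extended_eigenvalue_power\<close>). The functional is bounded by the
  Cauchy estimate on a smaller circle.

  Conversely, let \<open>C X = \<lambda> X C\<close> with \<open>X \<noteq> 0\<close>. As the polynomials are dense, some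
  \<open>g = X e\<^sub>k\<close> is nonzero, and \<open>C g = \<lambda> w\<^sup>k g\<close>. Some derivative \<open>g\<^sup>(\<^sup>j\<^sup>)(0)\<close> is nonzero, and
  taking the \<open>j\<close>-th derivative of both sides gives \<open>w\<^sup>j = \<lambda> w\<^sup>k\<close> (\<open>extended_eigenvalueE\<close>).

  Density is the analytic core, used in the form \<open>bounded_clinear_eq_0_on_monomials\<close>. It passes
  through the dilations \<open>f\<^sub>r(z) = f(rz)\<close>, \<open>r < 1\<close>: the Taylor series of \<open>f\<^sub>r\<close> converges
  absolutely in the Bergman norm (\<open>dilation_sums\<close>), and \<open>f\<^sub>r \<rightarrow> f\<close> as \<open>r \<rightarrow> 1\<close>
  (\<open>dilation_tendsto\<close>), since \<open>f\<^sub>r \<rightarrow> f\<close> pointwise while \<open>\<parallel>f\<^sub>r\<parallel> \<le> \<parallel>f\<parallel> / r\<close>.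
\<close>

section \<open>Complex scalars and the norm\<close>

lemma cinner_scaleC_right: "cinner x (c *\<^sub>C y) = cnj c * cinner x y"
  by (subst (1 2) cinner_commute) (simp add: cinner_scaleC_left)

lemma norm_scaleC [simp]: "norm (c *\<^sub>C x) = cmod c * norm x"
proof -
  have "complex_of_real ((norm (c *\<^sub>C x))\<^sup>2) = (c * cnj c) * cinner x x"
    by (simp only: cinner_self [symmetric] cinner_scaleC_left cinner_scaleC_right ac_simps)
  also have "\<dots> = complex_of_real ((cmod c * norm x)\<^sup>2)"
    by (simp add: cinner_self complex_norm_square [symmetric] power_mult_distrib)
  finally have "(norm (c *\<^sub>C x))\<^sup>2 = (cmod c * norm x)\<^sup>2"
    by (simp only: of_real_eq_iff)
  then show ?thesis
    by (simp add: power2_eq_iff_nonneg)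
qed

lemma scaleC_eq_0_iff [simp]: "c *\<^sub>C x = 0 \<longleftrightarrow> c = 0 \<or> x = 0"
  by (metis mult_eq_0_iff norm_eq_zero norm_scaleC)

section \<open>Monomials\<close>

lemma bergman_fun_holomorphic: "bergman_fun f holomorphic_on ball 0 1"
  using bergman_fun_sq_integrable by (simp add: sq_integrable_disk_def)

lemma sq_integrable_disk_bounded:
  assumes f: "f holomorphic_on ball 0 1" and B: "\<And>z. z \<in> ball 0 1 \<Longrightarrow> cmod (f z) \<le> B"
  shows "sq_integrable_disk f"
    and "(\<integral>\<^sup>+z. indicator (ball 0 1) z * ennreal ((cmod (f z))\<^sup>2) \<partial>lborel) \<le> ennreal (pi * B\<^sup>2)"
proof -
  have area: "emeasure lborel (ball (0::complex) 1) = ennreal pi"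
    by (subst emeasure_ball) (auto simp: unit_ball_vol_2)
  have "(\<integral>\<^sup>+z. indicator (ball 0 1) z * ennreal ((cmod (f z))\<^sup>2) \<partial>lborel)
      \<le> (\<integral>\<^sup>+z. indicator (ball 0 1) (z::complex) * ennreal (B\<^sup>2) \<partial>lborel)"
    by (intro nn_integral_mono) (auto simp: indicator_def intro!: ennreal_leI power_mono B)
  also have "\<dots> = ennreal (pi * B\<^sup>2)"
    by (subst nn_integral_multc) (auto simp: area ennreal_mult[symmetric])
  finally show *: "(\<integral>\<^sup>+z. indicator (ball 0 1) z * ennreal ((cmod (f z))\<^sup>2) \<partial>lborel) \<le> ennreal (pi * B\<^sup>2)" .
  with f show "sq_integrable_disk f"
    by (auto simp: sq_integrable_disk_iff intro: le_less_trans)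
qed

definition bergman_monomial :: "nat \<Rightarrow> bergman"
  where "bergman_monomial n = Abs_bergman (\<lambda>z. if z \<in> ball 0 1 then z ^ n else 0)"

lemma bergman_fun_monomial:
  "bergman_fun (bergman_monomial n) = (\<lambda>z. if z \<in> ball 0 1 then z ^ n else 0)"
  unfolding bergman_monomial_def
  by (rule bergman_fun_Abs, rule sq_integrable_disk_bounded(1) [where B = 1])
     (auto intro!: holomorphic_intros simp: norm_power power_le_one)

lemma norm_bergman_monomial_le: "norm (bergman_monomial n) \<le> 1"
proof -
  have "ennreal (pi * (norm (bergman_monomial n))\<^sup>2) \<le> ennreal (pi * 1\<^sup>2)"
    unfolding bergman_nn_integral [symmetric]
    by (rule sq_integrable_disk_bounded(2) [OF bergman_fun_holomorphic])
       (auto simp: bergman_fun_monomial norm_power power_le_one)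
  then have "(norm (bergman_monomial n))\<^sup>2 \<le> 1\<^sup>2"
    by (simp add: ennreal_le_iff)
  then show ?thesis
    by (rule power2_le_imp_le) simp
qed

lemma bergman_monomial_nonzero: "bergman_monomial n \<noteq> 0"
proof
  assume "bergman_monomial n = 0"
  then have "bergman_fun (bergman_monomial n) (1 / 2) = bergman_fun 0 (1 / 2)"
    by simp
  then show False
    by (simp add: bergman_fun_monomial dist_norm)
qed

lemma composition_rotation_monomial:
  assumes "cmod w = 1"
  shows "composition_operator (\<lambda>z. w * z) (bergman_monomial n) = w ^ n *\<^sub>C bergman_monomial n"
  by (rule bergman_eqI)
     (simp add: bergman_fun_composition_rotation assms bergman_fun_monomial norm_mult power_mult_distrib)

section \<open>Derivatives at the centre\<close>

definition deriv_at_0 :: "nat \<Rightarrow> bergman \<Rightarrow> complex"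
  where "deriv_at_0 k f = (deriv ^^ k) (bergman_fun f) 0"

lemma deriv_at_0_add: "deriv_at_0 k (f + g) = deriv_at_0 k f + deriv_at_0 k g"
proof -
  have "bergman_fun (f + g) = (\<lambda>z. bergman_fun f z + bergman_fun g z)"
    by (simp add: fun_eq_iff)
  then show ?thesis
    unfolding deriv_at_0_def
    using higher_deriv_add [OF bergman_fun_holomorphic bergman_fun_holomorphic, of 0 k f g] by simp
qed

lemma deriv_at_0_scaleC: "deriv_at_0 k (c *\<^sub>C f) = c * deriv_at_0 k f"
proof -
  have "bergman_fun (c *\<^sub>C f) = (\<lambda>z. c * bergman_fun f z)"
    by (simp add: fun_eq_iff)
  then show ?thesis
    unfolding deriv_at_0_def
    using higher_deriv_cmult [OF bergman_fun_holomorphic _ open_ball, of 0 k c f] by simp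
qed

text \<open>The Cauchy estimate on the circle of radius \<open>1/2\<close>, where point evaluation has norm at most
  \<open>1 / (1 - 1/2) = 2\<close>.\<close>

lemma deriv_at_0_bound: "cmod (deriv_at_0 k f) \<le> (2 * fact k * 2 ^ k) * norm f"
proof -
  have "cmod ((deriv ^^ k) (bergman_fun f) 0) \<le> fact k * (2 * norm f) / (1 / 2) ^ k"
  proof (rule Cauchy_inequality)
    show "bergman_fun f holomorphic_on ball 0 (1 / 2)"
      by (rule holomorphic_on_subset [OF bergman_fun_holomorphic]) auto
    show "continuous_on (cball 0 (1 / 2)) (bergman_fun f)"
      by (rule continuous_on_subset [OF holomorphic_on_imp_continuous_on [OF bergman_fun_holomorphic]]) auto
    show "cmod (bergman_fun f x) \<le> 2 * norm f" if "cmod (0 - x) = 1 / 2" for x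
    proof -
      have half: "cmod x = 1 / 2"
        using that by simp
      show ?thesis
        using bergman_point_norm [of x f] unfolding dist_norm mem_ball half
        by (simp add: half mult.commute)
    qed
  qed simp
  then show ?thesis
    by (simp add: deriv_at_0_def power_divide mult_ac)
qed

lemma deriv_at_0_monomial: "deriv_at_0 n (bergman_monomial n) = fact n"
proof -
  have "(deriv ^^ n) (bergman_fun (bergman_monomial n)) 0 = (deriv ^^ n) (\<lambda>z. (z - 0) ^ n) 0"
    by (rule higher_deriv_transform_within_open [OF bergman_fun_holomorphic _ open_ball])
       (auto intro!: holomorphic_intros simp: bergman_fun_monomial)
  also have "\<dots> = fact n"
    by (subst higher_deriv_power) (simp add: pochhammer_fact)
  finally show ?thesis
    by (simp add: deriv_at_0_def)
qed

lemma deriv_at_0_composition_rotation: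
  assumes w: "cmod w = 1"
  shows "deriv_at_0 k (composition_operator (\<lambda>z. w * z) f) = w ^ k * deriv_at_0 k f"
proof -
  have "bergman_fun (composition_operator (\<lambda>z. w * z) f) = (\<lambda>z. bergman_fun f (w * z))"
    by (simp add: fun_eq_iff bergman_fun_composition_rotation w)
  then show ?thesis
    unfolding deriv_at_0_def
    using higher_deriv_compose_linear [OF bergman_fun_holomorphic open_ball open_ball, of 0 0 1 w k f] w
    by (simp add: norm_mult)
qed

text \<open>The identity theorem: a holomorphic function on the disk is determined by its derivatives
  at the centre.\<close>

lemma bergman_nonzero_deriv_at_0:
  assumes "f \<noteq> 0"
  obtains k where "deriv_at_0 k f \<noteq> 0"
proof -
  have "f = 0" if "\<And>k. deriv_at_0 k f = 0"
  proof (rule bergman_eqI)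
    fix z :: complex assume "z \<in> ball 0 1"
    then show "bergman_fun f z = bergman_fun 0 z"
      using holomorphic_fun_eq_0_on_ball [OF bergman_fun_holomorphic, of z f] that
      by (simp add: deriv_at_0_def)
  qed
  with assms that show thesis by blast
qed

section \<open>Density of the polynomials\<close>

text \<open>Fatou's lemma applied to the squared moduli. The squared norm is used to match the integral and to
  fit the parallelogram law in the next lemma.\<close>

lemma bergman_norm_lower_semicontinuous:
  assumes lim: "\<And>z. z \<in> ball 0 1 \<Longrightarrow> (\<lambda>n. bergman_fun (F n) z) \<longlonglongrightarrow> bergman_fun f z"
    and c: "c < (norm f)\<^sup>2"
  shows "\<forall>\<^sub>F n in sequentially. c < (norm (F n))\<^sup>2"
proof (cases "c < 0")
  case True
  then show ?thesis
    by (intro always_eventually allI) (rule less_le_trans [OF True], simp)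
next
  case False
  define q where "q g z = indicator (ball 0 1) z * ennreal ((cmod (bergman_fun g z))\<^sup>2)" for g z
  have int: "(\<integral>\<^sup>+z. q g z \<partial>lborel) = ennreal (pi * (norm g)\<^sup>2)" for g
    unfolding q_def by (rule bergman_nn_integral)
  have [measurable]: "q g \<in> borel_measurable borel" for g
    unfolding q_def by (rule disk_density_measurable [OF bergman_fun_holomorphic])
  have lim_q: "q f z = liminf (\<lambda>n. q (F n) z)" for z
  proof (cases "z \<in> ball 0 1")
    case True
    have "(\<lambda>n. ennreal ((cmod (bergman_fun (F n) z))\<^sup>2)) \<longlonglongrightarrow> ennreal ((cmod (bergman_fun f z))\<^sup>2)"
      by (intro tendsto_intros tendsto_ennrealI lim True)
    from lim_imp_Liminf [OF _ this] True show ?thesis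
      by (simp add: q_def)
  qed (simp add: q_def Liminf_const)
  have "ennreal (pi * c) < ennreal (pi * (norm f)\<^sup>2)"
    using False c by (intro ennreal_lessI mult_strict_left_mono mult_pos_pos) auto
  also have "\<dots> \<le> liminf (\<lambda>n. \<integral>\<^sup>+z. q (F n) z \<partial>lborel)"
    unfolding int [symmetric] lim_q by (rule nn_integral_liminf) simp
  finally have "\<forall>\<^sub>F n in sequentially. ennreal (pi * c) < ennreal (pi * (norm (F n))\<^sup>2)"
    unfolding int by (rule less_LiminfD)
  then show ?thesis
    using False by (simp add: ennreal_less_iff)
qed

text \<open>Pointwise convergence without loss of norm in the limit is norm convergence. By the
  parallelogram law \<open>\<parallel>F\<^sub>n - f\<parallel>\<^sup>2 = 2\<parallel>F\<^sub>n\<parallel>\<^sup>2 + 2\<parallel>f\<parallel>\<^sup>2 - \<parallel>F\<^sub>n + f\<parallel>\<^sup>2\<close>; the first term is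
  asymptotically at most \<open>2\<parallel>f\<parallel>\<^sup>2\<close>, and lower semicontinuity along \<open>F\<^sub>n + f \<rightarrow> 2f\<close> makes the last
  one asymptotically at least \<open>4\<parallel>f\<parallel>\<^sup>2\<close>. This takes the place of dominated convergence, for which the
  dilations have no obvious common majorant.\<close>

lemma bergman_tendsto_if_pointwise:
  assumes lim: "\<And>z. z \<in> ball 0 1 \<Longrightarrow> (\<lambda>n. bergman_fun (F n) z) \<longlonglongrightarrow> bergman_fun f z"
    and bound: "\<And>n. norm (F n) \<le> b n" and b: "b \<longlonglongrightarrow> norm f"
  shows "F \<longlonglongrightarrow> f"
proof -
  have parallelogram: "(norm (x - y))\<^sup>2 = 2 * (norm x)\<^sup>2 + 2 * (norm y)\<^sup>2 - (norm (x + y))\<^sup>2" for x y :: bergman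
    by (simp add: power2_norm_eq_inner inner_diff inner_add inner_commute)
  have "(\<lambda>n. (norm (F n - f))\<^sup>2) \<longlonglongrightarrow> 0"
  proof (rule order_tendstoI)
    fix e :: real assume e: "0 < e"
    have b2: "(\<lambda>n. (b n)\<^sup>2) \<longlonglongrightarrow> (norm f)\<^sup>2"
      by (intro tendsto_intros b)
    have small: "\<forall>\<^sub>F n in sequentially. (b n)\<^sup>2 < (norm f)\<^sup>2 + e / 4"
      by (rule order_tendstoD [OF b2]) (use e in simp)
    have large: "\<forall>\<^sub>F n in sequentially. 4 * (norm f)\<^sup>2 - e / 2 < (norm (F n + f))\<^sup>2"
    proof (rule bergman_norm_lower_semicontinuous [where f = "f + f"])
      show "(\<lambda>n. bergman_fun (F n + f) z) \<longlonglongrightarrow> bergman_fun (f + f) z" if "z \<in> ball 0 1" for z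
        by (unfold bergman_fun_add, intro tendsto_add tendsto_const lim that)
      have "norm (f + f) = 2 * norm f"
        by (simp add: scaleR_2 [symmetric])
      then show "4 * (norm f)\<^sup>2 - e / 2 < (norm (f + f))\<^sup>2"
        using e by (simp add: power_mult_distrib)
    qed
    show "\<forall>\<^sub>F n in sequentially. (norm (F n - f))\<^sup>2 < e"
      using small large
    proof eventually_elim
      case (elim n)
      have "(norm (F n))\<^sup>2 \<le> (b n)\<^sup>2"
        by (intro power_mono bound norm_ge_zero)
      with elim show ?case
        unfolding parallelogram by linarith
    qed
  qed (auto intro!: always_eventually intro: less_le_trans)
  then have "(\<lambda>n. sqrt ((norm (F n - f))\<^sup>2)) \<longlonglongrightarrow> sqrt 0"
    by (rule tendsto_real_sqrt)
  then show ?thesis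
    by (simp add: LIM_zero_iff tendsto_norm_zero_iff)
qed

definition dilation :: "real \<Rightarrow> bergman \<Rightarrow> bergman"
  where "dilation r f = Abs_bergman (\<lambda>z. if z \<in> ball 0 1 then bergman_fun f (r *\<^sub>R z) else 0)"

lemma scale_in_disk:
  assumes "0 < r" "r < 1" "z \<in> ball 0 1"
  shows "r *\<^sub>R z \<in> ball (0::complex) 1"
proof -
  have "r * cmod z \<le> cmod z"
    using assms by (intro mult_left_le_one_le) auto
  then show ?thesis
    using assms by simp
qed

text \<open>The substitution \<open>u = r z\<close> turns the integral of \<open>\<bar>f(r z)\<bar>\<^sup>2\<close> over the disk into \<open>1 / r\<^sup>2\<close>
  times the integral of \<open>\<bar>f\<bar>\<^sup>2\<close> over the disk of radius \<open>r\<close>. This gives both the norm estimate and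
  the fact that the dilation lies in the Bergman space.\<close>

lemma dilation_facts:
  assumes r: "0 < r" "r < 1"
  shows bergman_fun_dilation: "z \<in> ball 0 1 \<Longrightarrow> bergman_fun (dilation r f) z = bergman_fun f (r *\<^sub>R z)"
    and norm_dilation_le: "norm (dilation r f) \<le> norm f / r"
proof -
  define q where "q g z = indicator (ball 0 1) z * ennreal ((cmod (g z))\<^sup>2)" for g :: "complex \<Rightarrow> complex" and z
  have [measurable]: "q (bergman_fun f) \<in> borel_measurable borel"
    unfolding q_def by (rule disk_density_measurable [OF bergman_fun_holomorphic])
  have hol: "(\<lambda>z. bergman_fun f (r *\<^sub>R z)) holomorphic_on ball 0 1"
    by (rule holomorphic_on_compose_gen [OF _ bergman_fun_holomorphic, of "\<lambda>z. r *\<^sub>R z", unfolded o_def])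
       (use scale_in_disk [OF r] in \<open>auto intro!: holomorphic_intros simp: scaleR_conv_of_real\<close>)
  have "ennreal (r\<^sup>2) * (\<integral>\<^sup>+z. q (\<lambda>z. bergman_fun f (r *\<^sub>R z)) z \<partial>lborel)
      \<le> ennreal (r\<^sup>2) * (\<integral>\<^sup>+z. q (bergman_fun f) (0 + r *\<^sub>R z) \<partial>lborel)"
    by (intro mult_left_mono nn_integral_mono)
       (use scale_in_disk [OF r] in \<open>auto simp: q_def indicator_def\<close>)
  also have "\<dots> = ennreal (pi * (norm f)\<^sup>2)"
    using nn_integral_complex_affine [of "q (bergman_fun f)" r 0] r bergman_nn_integral [of f]
    by (simp add: q_def)
  finally have le: "ennreal (r\<^sup>2) * (\<integral>\<^sup>+z. q (\<lambda>z. bergman_fun f (r *\<^sub>R z)) z \<partial>lborel) \<le> ennreal (pi * (norm f)\<^sup>2)" .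
  then have "(\<integral>\<^sup>+z. q (\<lambda>z. bergman_fun f (r *\<^sub>R z)) z \<partial>lborel) < \<infinity>"
    using r by (auto simp: ennreal_mult_top top_unique less_top[symmetric])
  with hol have "sq_integrable_disk (\<lambda>z. bergman_fun f (r *\<^sub>R z))"
    by (simp add: sq_integrable_disk_iff q_def)
  from bergman_fun_Abs [OF this]
  have eq: "bergman_fun (dilation r f) z = bergman_fun f (r *\<^sub>R z)" if "z \<in> ball 0 1" for z
    using that by (simp add: dilation_def)
  then show "z \<in> ball 0 1 \<Longrightarrow> bergman_fun (dilation r f) z = bergman_fun f (r *\<^sub>R z)" .
  have "(\<integral>\<^sup>+z. q (\<lambda>z. bergman_fun f (r *\<^sub>R z)) z \<partial>lborel) = ennreal (pi * (norm (dilation r f))\<^sup>2)"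
    unfolding bergman_nn_integral [symmetric] q_def
    by (intro nn_integral_cong) (auto simp: eq indicator_def)
  with le have "r\<^sup>2 * (pi * (norm (dilation r f))\<^sup>2) \<le> pi * (norm f)\<^sup>2"
    by (simp add: ennreal_mult [symmetric] ennreal_le_iff)
  then have "(norm (dilation r f) * r)\<^sup>2 \<le> (norm f)\<^sup>2"
    by (simp add: power_mult_distrib mult_ac)
  then have "norm (dilation r f) * r \<le> norm f"
    by (rule power2_le_imp_le) simp
  then show "norm (dilation r f) \<le> norm f / r"
    using r by (simp add: pos_le_divide_eq)
qed

text \<open>Any radii in \<open>(0, 1)\<close> tending to \<open>1\<close> would do; the shift by \<open>2\<close> keeps the first radius
  positive.\<close>

lemma dilation_tendsto: "(\<lambda>n. dilation (1 - inverse (real (n + 2))) f) \<longlonglongrightarrow> f"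
proof (rule bergman_tendsto_if_pointwise)
  define r where "r n = 1 - inverse (real (n + 2))" for n
  have r: "0 < r n" "r n < 1" for n
    by (auto simp: r_def field_simps)
  have r_lim: "r \<longlonglongrightarrow> 1"
    unfolding r_def using tendsto_diff [OF tendsto_const LIMSEQ_ignore_initial_segment [OF lim_inverse_n, of 2], of 1]
    by simp
  show "norm (dilation (1 - inverse (real (n + 2))) f) \<le> norm f / r n" for n
    using norm_dilation_le [OF r] by (simp add: r_def)
  show "(\<lambda>n. norm f / r n) \<longlonglongrightarrow> norm f"
    using tendsto_divide [OF tendsto_const r_lim, of "norm f"] by simp
  fix z :: complex assume z: "z \<in> ball 0 1"
  have "isCont (bergman_fun f) z"
    using z holomorphic_on_imp_continuous_on [OF bergman_fun_holomorphic]
    by (simp add: continuous_on_eq_continuous_at)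
  moreover have "(\<lambda>n. r n *\<^sub>R z) \<longlonglongrightarrow> z"
    using tendsto_scaleR [OF r_lim tendsto_const, of z] by simp
  ultimately have "(\<lambda>n. bergman_fun f (r n *\<^sub>R z)) \<longlonglongrightarrow> bergman_fun f z"
    by (rule isCont_tendsto_compose)
  then show "(\<lambda>n. bergman_fun (dilation (1 - inverse (real (n + 2))) f) z) \<longlonglongrightarrow> bergman_fun f z"
    using bergman_fun_dilation [OF r z] by (simp add: r_def)
qed

lemma bounded_linear_bergman_fun: "bounded_linear (\<lambda>f. bergman_fun f z)"
proof (cases "z \<in> ball 0 1")
  case True
  then show ?thesis
    by (intro bounded_linear_intro [where K = "inverse (1 - cmod z)"])
       (use bergman_point_norm [OF True] in \<open>auto simp: scaleR_conv_of_real divide_inverse\<close>)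
qed (simp add: bounded_linear_zero)

text \<open>The Taylor series of \<open>f\<close> converges absolutely at the interior point \<open>r\<close>, and monomials have
  norm at most \<open>1\<close>, so the Taylor series of the dilation converges absolutely in the complete Bergman
  space. Point evaluations are continuous, which identifies its sum.\<close>

lemma dilation_sums:
  assumes r: "0 < r" "r < 1"
  shows "(\<lambda>n. (deriv_at_0 n f / fact n * of_real r ^ n) *\<^sub>C bergman_monomial n) sums dilation r f"
proof -
  define c where "c n = deriv_at_0 n f / fact n * of_real r ^ n" for n
  have taylor: "(\<lambda>n. deriv_at_0 n f / fact n * u ^ n) sums bergman_fun f u" if "u \<in> ball 0 1" for u
    using holomorphic_power_series [OF bergman_fun_holomorphic that] by (simp add: deriv_at_0_def)
  \<comment> \<open>Convergence at a point of larger modulus forces absolute convergence at \<open>r\<close>.\<close>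
  define s where "s = (1 + r) / 2"
  have s: "r < s" "s < 1"
    using r by (auto simp: s_def)
  have "summable (\<lambda>n. deriv_at_0 n f / fact n * of_real s ^ n)"
    using taylor [of "of_real s"] s r by (auto simp: sums_iff)
  from powser_insidea [OF this, of "of_real r"] have sum_c: "summable (\<lambda>n. norm (c n))"
    using r s by (simp add: c_def)
  have "summable (\<lambda>n. c n *\<^sub>C bergman_monomial n)"
  proof (rule summable_norm_cancel, rule summable_comparison_test [OF _ sum_c], intro exI allI impI)
    show "norm (norm (c n *\<^sub>C bergman_monomial n)) \<le> norm (c n)" for n
      using mult_left_mono [OF norm_bergman_monomial_le, of "cmod (c n)" n] by simp
  qed
  then obtain g where g: "(\<lambda>n. c n *\<^sub>C bergman_monomial n) sums g"
    by (auto simp: summable_def)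
  have "g = dilation r f"
  proof (rule bergman_eqI)
    fix z :: complex assume z: "z \<in> ball 0 1"
    have "(\<lambda>n. bergman_fun (c n *\<^sub>C bergman_monomial n) z) sums bergman_fun g z"
      by (rule bounded_linear.sums [OF bounded_linear_bergman_fun g])
    moreover have "(\<lambda>n. bergman_fun (c n *\<^sub>C bergman_monomial n) z)
        = (\<lambda>n. deriv_at_0 n f / fact n * (r *\<^sub>R z) ^ n)"
      using z by (simp add: bergman_fun_monomial c_def scaleR_conv_of_real power_mult_distrib mult_ac)
    ultimately show "bergman_fun g z = bergman_fun (dilation r f) z"
      using taylor [OF scale_in_disk [OF r z]] by (simp add: bergman_fun_dilation [OF r z] sums_iff)
  qed
  with g show ?thesis
    by (simp add: c_def)
qed

text \<open>This says that the polynomials are dense: \<open>X\<close> kills the norm-convergent Taylor series of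
  each dilation of \<open>f\<close>, hence the limit \<open>f\<close> of the dilations.\<close>

lemma bounded_clinear_eq_0_on_monomials:
  assumes X: "bounded_clinear X" and mono: "\<And>n. X (bergman_monomial n) = 0"
  shows "X = (\<lambda>f. 0)"
proof
  fix f
  have lin: "bounded_linear X" and sc: "\<And>c x. X (c *\<^sub>C x) = c *\<^sub>C X x"
    using X by (auto simp: bounded_clinear_def)
  have "X (dilation r f) = 0" if r: "0 < r" "r < 1" for r
    using bounded_linear.sums [OF lin dilation_sums [OF r, of f]]
    by (simp add: sc mono scaleC_eq_0_iff [THEN iffD2] sums_iff)
  then have "X (dilation (1 - inverse (real (n + 2))) f) = 0" for n
    by (simp add: field_simps)
  then have "(\<lambda>n. 0) \<longlonglongrightarrow> X f"
    using bounded_linear.tendsto [OF lin dilation_tendsto, of f] by simp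
  then show "X f = 0"
    by (simp add: LIMSEQ_const_iff)
qed

section \<open>Extended eigenvalues of rotations\<close>

text \<open>The witness is a rank-one operator mapping into the eigenspace of \<open>w ^ j\<close>, built from a
  functional that the rotation multiplies by \<open>w ^ k\<close>.\<close>

lemma extended_eigenvalue_power:
  assumes w: "cmod w = 1"
  shows "extended_eigenvalue (composition_operator (\<lambda>z. w * z)) (w ^ j / w ^ k)"
proof -
  define X where "X f = deriv_at_0 k f *\<^sub>C bergman_monomial j" for f
  have "X (bergman_monomial k) \<noteq> 0"
    by (simp add: X_def deriv_at_0_monomial bergman_monomial_nonzero)
  moreover have "bounded_clinear X"
    unfolding bounded_clinear_def
  proof (intro conjI allI)
    show "bounded_linear X"
    proof (rule bounded_linear_intro)
      show "norm (X f) \<le> norm f * (2 * fact k * 2 ^ k)" for f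
        using mult_mono [OF deriv_at_0_bound norm_bergman_monomial_le, of k f j]
        by (simp add: X_def mult_ac)
    qed (simp_all add: X_def deriv_at_0_add deriv_at_0_scaleC scaleR_scaleC scaleC_add_left scaleC_scaleC)
  qed (simp add: X_def deriv_at_0_scaleC scaleC_scaleC)
  moreover have "composition_operator (\<lambda>z. w * z) (X f)
      = (w ^ j / w ^ k) *\<^sub>C X (composition_operator (\<lambda>z. w * z) f)" for f
  proof -
    have "w \<noteq> 0"
      using w by auto
    with bounded_clinear_composition_rotation [OF w] show ?thesis
      by (simp add: X_def bounded_clinear_def composition_rotation_monomial [OF w]
          deriv_at_0_composition_rotation [OF w] scaleC_scaleC mult.commute [of "deriv_at_0 k f"])
  qed
  ultimately show ?thesis
    unfolding extended_eigenvalue_def by blast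
qed

text \<open>An intertwiner sends an eigenvector for \<open>\<mu>\<close> to zero or to an eigenvector for
  \<open>l * \<mu>\<close>. The monomials cannot all be sent to zero, and the only eigenvalues of the rotation are
  the powers \<open>w ^ j\<close>, as any nonvanishing derivative of an eigenvector at \<open>0\<close> shows.\<close>

lemma extended_eigenvalueE:
  assumes w: "cmod w = 1" and ev: "extended_eigenvalue (composition_operator (\<lambda>z. w * z)) l"
  obtains j k where "l = w ^ j / w ^ k"
proof -
  let ?C = "composition_operator (\<lambda>z. w * z)"
  obtain X where X: "bounded_clinear X" "X \<noteq> (\<lambda>f. 0)" and comm: "\<And>f. ?C (X f) = l *\<^sub>C X (?C f)"
    using ev unfolding extended_eigenvalue_def by blast
  obtain k where "X (bergman_monomial k) \<noteq> 0"
    using bounded_clinear_eq_0_on_monomials [OF X(1)] X(2) by blast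
  then obtain j where j: "deriv_at_0 j (X (bergman_monomial k)) \<noteq> 0"
    by (rule bergman_nonzero_deriv_at_0)
  have "?C (X (bergman_monomial k)) = (l * w ^ k) *\<^sub>C X (bergman_monomial k)"
    using X(1) by (simp add: comm composition_rotation_monomial [OF w] bounded_clinear_def scaleC_scaleC)
  then have "deriv_at_0 j (?C (X (bergman_monomial k)))
      = (l * w ^ k) * deriv_at_0 j (X (bergman_monomial k))"
    by (simp add: deriv_at_0_scaleC)
  with j have "w ^ j = l * w ^ k"
    by (simp add: deriv_at_0_composition_rotation [OF w])
  moreover have "w \<noteq> 0"
    using w by auto
  ultimately have "l = w ^ j / w ^ k"
    by simp
  then show thesis
    by (rule that)
qed

theorem theorem4p3:
  fixes w :: complex
  assumes "cmod w = 1"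
  shows "Ext (composition_operator (\<lambda>z. w * z)) = {w powi n | n :: int. True}"
proof (intro equalityI subsetI)
  have w0: "w \<noteq> 0"
    using assms by auto
  have powi: "w powi (int j - int k) = w ^ j / w ^ k" for j k
    using w0 by (simp add: power_int_diff)
  fix l
  {
    assume "l \<in> Ext (composition_operator (\<lambda>z. w * z))"
    then obtain j k where "l = w ^ j / w ^ k"
      using extended_eigenvalueE [OF assms] by (auto simp: Ext_def)
    with powi show "l \<in> {w powi n | n :: int. True}"
      by (metis (mono_tags, lifting) mem_Collect_eq)
  next
    assume "l \<in> {w powi n | n :: int. True}"
    then obtain n :: int where n: "l = w powi n"
      by auto
    \<comment> \<open>One of the two exponents is \<open>0\<close>, according to the sign of \<open>n\<close>.\<close>
    have "l = w ^ nat n / w ^ nat (- n)"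
      unfolding n powi [symmetric] by (rule arg_cong [of _ _ "power_int w"]) simp
    then show "l \<in> Ext (composition_operator (\<lambda>z. w * z))"
      using extended_eigenvalue_power [OF assms] by (simp add: Ext_def)
  }
qed

end
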